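(* Let $q=p^e$ be a prime power, $\ell$ an odd prime with $\ell\neq p$, and $n$ a positive integer divisible by neither $p$ nor $\ell$. Let $\gamma\in\mathbb{Z}$ and $\tau=|c_n(\gamma)|$. Assume that $\ell\nmid q^\tau-1$, and put $r=\frac{\ell-1}{\mathrm{ord}_\ell(q^\tau)}$ and $v=v_\ell(q^{\tau\cdot\mathrm{ord}_\ell(q^\tau)}-1)$. Then: (1) Every component of the sequence $\mathfrak{c}_\infty(\gamma)=\bigl(c_{\ell^i n}(\gamma+n\cdot\varphi(\gamma)_{\leq i-1})\bigr)_{i\in\mathbb{N}}$ has size $\tau$. (2) For every $(m,a)\in\mathbb{N}\times[1,r]$ and $t\in[0,\ell^{v-1}-1]$, the sizes of the components of the sequence $\mathfrak{c}_{m,a,t}(\gamma)=\bigl(c_{\ell^i n}(\gamma+n(U(\gamma;m,a)+\ell^{m+1}t))\bigr)_{i\in\mathbb{N}}$ are $$|c_{\ell^i n}(\gamma+n(U(\gamma;m,a)+\ell^{m+1}t))|=\begin{cases}\tau, & 0\leq i\leq m,\\ \mathrm{ord}_\ell(q^\tau)\cdot\tau, & m+1\leq i\leq m+v,\\ \ell^{i-m-v}\cdot\mathrm{ord}_\ell(q^\tau)\cdot\tau, & i\geq m+v+1.\end{cases}$$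
   Context: Notation: $\mathbb{N}=\{0,1,2,\dots\}$; $[a,b]$ is the set of integers from $a$ to $b$; $v_\ell$ is the $\ell$-adic valuation; $\mathrm{ord}_\ell(x)$ is the multiplicative order of $x$ modulo $\ell$. For $M\geq1$ coprime to $q$ and $\gamma\in\mathbb{Z}$, the $q$-cyclotomic coset modulo $M$ containing $\gamma$ is $c_M(\gamma)=\{\gamma,\gamma q,\dots,\gamma q^{\tau-1}\}\subseteq\mathbb{Z}/M\mathbb{Z}$, where $\tau$ is the least positive integer with $\gamma q^\tau\equiv\gamma\pmod M$; its size is $|c_M(\gamma)|=\tau$. $\varphi(\gamma)=-\gamma/n\in\mathbb{Z}_\ell$, with $\ell$-adic expansion $\varphi(\gamma)=\sum_{k\geq0}\phi_k\ell^k$, $\phi_k\in[0,\ell-1]$. For $i\geq0$, $\varphi(\gamma)_{\leq i}=\sum_{k=0}^i\phi_k\ell^k$, and $\varphi(\gamma)_{\leq-1}=0$. Fix $\Sigma_\tau=\{\sigma_1<\cdots<\sigma_r\}\subseteq[1,\ell-1]$, a full set of representatives of the quotient group $(\mathbb{Z}/\ell\mathbb{Z})^*/\langle q^\tau\rangle$. For $m\in\mathbb{N}$ and $a\in[1,r]$ put $U(\gamma;m,a)=\sum_{k=0}^{m-1}\phi_k\ell^k+u\,\ell^m$, where $u\in[0,\ell-1]$ is the unique integer with $u\equiv\phi_m+\sigma_a\pmod\ell$. *)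

theory Defs
  imports "HOL-Number_Theory.Number_Theory" "HOL-Algebra.Generated_Groups"
begin

text \<open>Residue classes modulo \<open>M\<close> are encoded by their representatives in
  \<open>{0..M - 1}\<close>, the carrier of \<^term>\<open>residue_ring (int M)\<close>.\<close>

definition coset_period :: "nat \<Rightarrow> nat \<Rightarrow> int \<Rightarrow> nat" where
  "coset_period q M \<gamma> = (LEAST t. 0 < t \<and> [\<gamma> * int q ^ t = \<gamma>] (mod int M))"

definition cyclotomic_coset :: "nat \<Rightarrow> nat \<Rightarrow> int \<Rightarrow> int set" where
  "cyclotomic_coset q M \<gamma> = (\<lambda>j. (\<gamma> * int q ^ j) mod int M) ` {..<coset_period q M \<gamma>}"

definition ladic_abs :: "nat \<Rightarrow> rat \<Rightarrow> real" where
  "ladic_abs l x = (if x = 0 then 0 else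
     real l powi (int (multiplicity (int l) (snd (quotient_of x)))
                  - int (multiplicity (int l) (fst (quotient_of x)))))"

text \<open>Only rational \<open>l\<close>-adic integers are needed, so the \<open>l\<close>-adic numbers are not constructed:
  a rational \<open>x\<close> equals the series \<open>\<Sum>k. d k * l ^ k\<close> in the \<open>l\<close>-adic integers iff the
  partial sums converge to \<open>x\<close> for the \<open>l\<close>-adic absolute value. For \<open>l\<close> prime and \<open>x\<close> with
  denominator prime to \<open>l\<close> there is exactly one such sequence \<open>d\<close> of digits.\<close>

definition ladic_digits :: "nat \<Rightarrow> rat \<Rightarrow> nat \<Rightarrow> int" where
  "ladic_digits l x = (THE d. (\<forall>k. d k \<in> {0..int l - 1}) \<and>
     (\<lambda>N. ladic_abs l (x - of_int (\<Sum>k<N. d k * int l ^ k))) \<longlonglongrightarrow> 0)"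

definition phi_digit :: "nat \<Rightarrow> nat \<Rightarrow> int \<Rightarrow> nat \<Rightarrow> int" where
  "phi_digit l n \<gamma> = ladic_digits l (- (of_int \<gamma> / of_nat n))"

text \<open>The truncation \<open>\<phi>(\<gamma>)\<^sub>\<le>\<^sub>i\<close>, with an integer index so that \<open>i = -1\<close> gives the empty sum.\<close>

definition phi_trunc :: "nat \<Rightarrow> nat \<Rightarrow> int \<Rightarrow> int \<Rightarrow> int" where
  "phi_trunc l n \<gamma> i = (\<Sum>k | int k \<le> i. phi_digit l n \<gamma> k * int l ^ k)"

definition full_set_of_reps :: "('a, 'b) monoid_scheme \<Rightarrow> 'a set \<Rightarrow> 'a set \<Rightarrow> bool" where
  "full_set_of_reps G H S \<longleftrightarrow>
     S \<subseteq> carrier G \<and> (\<forall>C \<in> carrier (G Mod H). \<exists>!s. s \<in> S \<and> s \<in> C)"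

abbreviation unit_group_mod :: "nat \<Rightarrow> int monoid" where
  "unit_group_mod l \<equiv> units_of (residue_ring (int l))"

definition U_int :: "nat \<Rightarrow> nat \<Rightarrow> int \<Rightarrow> (nat \<Rightarrow> int) \<Rightarrow> nat \<Rightarrow> nat \<Rightarrow> int" where
  "U_int l n \<gamma> \<sigma> m a = (\<Sum>k<m. phi_digit l n \<gamma> k * int l ^ k)
     + ((phi_digit l n \<gamma> m + \<sigma> a) mod int l) * int l ^ m"

definition coset_seq_inf :: "nat \<Rightarrow> nat \<Rightarrow> nat \<Rightarrow> int \<Rightarrow> nat \<Rightarrow> int set" where
  "coset_seq_inf q l n \<gamma> i =
     cyclotomic_coset q (l ^ i * n) (\<gamma> + int n * phi_trunc l n \<gamma> (int i - 1))"

definition coset_seq ::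
    "nat \<Rightarrow> nat \<Rightarrow> nat \<Rightarrow> (nat \<Rightarrow> int) \<Rightarrow> int \<Rightarrow> nat \<Rightarrow> nat \<Rightarrow> nat \<Rightarrow> nat \<Rightarrow> int set" where
  "coset_seq q l n \<sigma> \<gamma> m a t i =
     cyclotomic_coset q (l ^ i * n) (\<gamma> + int n * (U_int l n \<gamma> \<sigma> m a + int l ^ (m + 1) * int t))"

end

theory Submission
  imports Defs
begin

text \<open>Since \<open>l\<close> and \<open>n\<close> are coprime and \<open>\<delta> \<equiv> \<gamma> (mod n)\<close>, the coset of \<open>\<delta>\<close> modulo \<open>l\<^sup>i n\<close> has size
  \<open>\<tau> D\<close>, where \<open>D\<close> is the least positive \<open>s\<close> with \<open>l\<^sup>i\<close> dividing \<open>\<delta> (Q\<^sup>s - 1)\<close> for \<open>Q = q\<^sup>\<tau>\<close>.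
  Truncating the expansion of \<open>-\<gamma>/n\<close> makes \<open>\<delta>\<close> divisible by \<open>l\<^sup>i\<close>, so \<open>D = 1\<close>; perturbing the
  \<open>m\<close>-th digit by a unit makes the \<open>l\<close>-adic valuation of \<open>\<delta>\<close> exactly \<open>m\<close>, so \<open>D\<close> is the order
  of \<open>Q\<close> modulo \<open>l\<^sup>i\<^sup>-\<^sup>m\<close>, which lifting the exponent computes.\<close>

section \<open>Lifting the exponent for differences \<open>x ^ j - 1\<close>\<close>

lemma multiplicity_of_nat_int: "multiplicity (int p) (int x) = multiplicity p x"
  unfolding multiplicity_def by (simp flip: of_nat_power)

text \<open>The cofactor of \<open>x - 1\<close> in \<open>x ^ j - 1\<close> is a sum of
  \<open>j\<close> powers of \<open>x\<close>, hence congruent to \<open>j\<close> modulo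
  \<open>l\<close> and prime to \<open>l\<close>.\<close>

lemma multiplicity_power_diff_1_coprime:
  fixes x :: int
  assumes "prime l" and "int l dvd x - 1" and "x > 1" and "\<not> l dvd j"
  shows "multiplicity (int l) (x ^ j - 1) = multiplicity (int l) (x - 1)"
proof -
  have j: "j > 0" using assms(4) by (cases j) auto
  have "[x = 1] (mod int l)"
    using assms(2) by (simp add: cong_iff_dvd_diff)
  hence "[(\<Sum>i<j. x ^ i) = (\<Sum>i<j. 1 ^ i)] (mod int l)"
    by (intro cong_sum cong_pow)
  hence "\<not> int l dvd (\<Sum>i<j. x ^ i)"
    using assms(4) by (simp add: cong_dvd_iff)
  hence z: "multiplicity (int l) (\<Sum>i<j. x ^ i) = 0"
    by (rule not_dvd_imp_multiplicity_0)
  \<comment> \<open>\<open>multiplicity\<close> takes the value 0 at 0, so it is additive on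
    products only when both factors are nonzero.\<close>
  have "x ^ j - 1 \<noteq> 0" using one_less_power[OF assms(3) j] by simp
  hence nz: "(\<Sum>i<j. x ^ i) \<noteq> 0" "x - 1 \<noteq> 0" unfolding power_diff_1_eq by auto
  show ?thesis
    unfolding power_diff_1_eq
    using prime_elem_multiplicity_mult_distrib[OF _ nz(2,1), of "int l"] z assms(1) by simp
qed

lemma cong_one_plus_power:
  fixes a :: int
  shows "[(1 + a) ^ i = 1 + int i * a] (mod a\<^sup>2)"
proof (induction i)
  case (Suc i)
  have "[(1 + a) ^ Suc i = (1 + int i * a) * (1 + a)] (mod a\<^sup>2)"
    using cong_mult[OF Suc cong_refl[of "1 + a"]] by (simp add: mult.commute)
  also have "[(1 + int i * a) * (1 + a) = 1 + int (Suc i) * a] (mod a\<^sup>2)"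
    by (simp add: cong_iff_dvd_diff algebra_simps power2_eq_square)
  finally show ?case .
qed simp

text \<open>With \<open>x = 1 + l z\<close>, the cofactor of \<open>x - 1\<close> is
  \<open>l + l z * (l (l - 1) / 2)\<close> modulo \<open>l^2\<close>. As \<open>l\<close> is odd,
  \<open>(l - 1) / 2\<close> is an integer, so the second term vanishes modulo \<open>l^2\<close>
  and the cofactor has valuation exactly 1.\<close>

lemma multiplicity_power_diff_1_prime:
  fixes x :: int
  assumes "prime l" and "odd l" and "int l dvd x - 1" and "x > 1"
  shows "multiplicity (int l) (x ^ l - 1) = Suc (multiplicity (int l) (x - 1))"
proof -
  have l: "l > 1" using assms(1) by (rule prime_gt_1_nat)
  obtain z where z: "x = 1 + int l * z" using assms(3) by (metis add.commute diff_add_cancel dvdE)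
  obtain c where c: "l = 2 * c + 1" using assms(2) by (auto elim: oddE)
  have "[x ^ i = 1 + int i * (int l * z)] (mod (int l)\<^sup>2)" for i
    using cong_one_plus_power[of "int l * z" i] unfolding z power_mult_distrib
    by (rule cong_modulus_mult)
  hence "[(\<Sum>i<l. x ^ i) = (\<Sum>i<l. 1 + int i * (int l * z))] (mod (int l)\<^sup>2)"
    by (intro cong_sum)
  also have "(\<Sum>i<l. 1 + int i * (int l * z)) = int l + (\<Sum>i<l. int i) * (int l * z)"
    by (simp add: sum.distrib sum_distrib_right)
  also have "(\<Sum>i<l. int i) = int l * int c"
  proof -
    have "2 * (\<Sum>i<k. int i) = int k * (int k - 1)" for k
      by (induction k) (auto simp: algebra_simps)
    from this[of l] show ?thesis using c by simp
  qed
  also have "[int l + int l * int c * (int l * z) = int l] (mod (int l)\<^sup>2)"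
    by (simp add: cong_iff_dvd_diff power2_eq_square)
  finally have S: "[(\<Sum>i<l. x ^ i) = int l] (mod (int l)\<^sup>2)" .
  have "int l dvd (\<Sum>i<l. x ^ i)"
    using cong_dvd_modulus[OF S, of "int l"] by (simp add: cong_dvd_iff)
  moreover have "\<not> (int l)\<^sup>2 dvd int l"
    using l by (auto dest!: zdvd_imp_le simp: power2_eq_square)
  hence "\<not> (int l)\<^sup>2 dvd (\<Sum>i<l. x ^ i)"
    using cong_dvd_iff[OF S] by simp
  ultimately have mS: "multiplicity (int l) (\<Sum>i<l. x ^ i) = 1"
    by (intro multiplicity_eqI) (auto simp: power2_eq_square)
  have "x ^ l - 1 \<noteq> 0" using one_less_power[OF assms(4), of l] l by simp
  hence nz: "(\<Sum>i<l. x ^ i) \<noteq> 0" "x - 1 \<noteq> 0" unfolding power_diff_1_eq by auto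
  show ?thesis
    unfolding power_diff_1_eq
    using prime_elem_multiplicity_mult_distrib[OF _ nz(2,1), of "int l"] mS assms(1) by simp
qed

text \<open>Split \<open>j = l^k y\<close> with \<open>y\<close> prime to \<open>l\<close>: each of
  the \<open>k\<close> successive \<open>l\<close>-th powers adds one to the valuation, and the
  final exponent \<open>y\<close> adds nothing.\<close>

lemma multiplicity_power_diff_1:
  fixes x :: int
  assumes "prime l" and "odd l" and "int l dvd x - 1" and "x > 1" and "j > 0"
  shows "multiplicity (int l) (x ^ j - 1) = multiplicity (int l) (x - 1) + multiplicity l j"
proof -
  obtain y where y: "j = l ^ multiplicity l j * y" "\<not> l dvd y"
    using multiplicity_decompose'[of j l] assms(1,5) by (metis not_prime_unit gr_implies_not0)
  have d: "int l dvd x ^ i - 1" for i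
    using assms(3) unfolding power_diff_1_eq by auto
  have g: "x ^ (l ^ k) > 1" for k
    using assms(1,4) by (intro one_less_power) (auto simp: prime_gt_0_nat)
  have p: "multiplicity (int l) (x ^ (l ^ k) - 1) = multiplicity (int l) (x - 1) + k" for k
  proof (induction k)
    case (Suc k)
    have "x ^ (l ^ Suc k) = (x ^ (l ^ k)) ^ l" by (simp add: mult.commute flip: power_mult)
    thus ?case
      using multiplicity_power_diff_1_prime[OF assms(1,2) d g] Suc by simp
  qed simp
  have "x ^ j = (x ^ (l ^ multiplicity l j)) ^ y"
    by (subst y(1)) (rule power_mult)
  thus ?thesis
    using multiplicity_power_diff_1_coprime[OF assms(1) d g y(2)] p by simp
qed

text \<open>As \<open>k > 0\<close>, the left side forces \<open>ord l Q dvd s\<close>, and lifting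
  the exponent then applies to the base \<open>Q ^ ord l Q\<close>. The subtraction in the exponent
  is truncated: for small \<open>k\<close> the power of \<open>l\<close> is 1, which produces the
  plateau in the coset sizes.\<close>

lemma prime_power_dvd_power_diff_1_iff:
  assumes "prime l" and "odd l" and "coprime l Q" and "Q > 1" and "k > 0"
  shows "int l ^ k dvd int Q ^ s - 1 \<longleftrightarrow>
    l ^ (k - multiplicity l (Q ^ ord l Q - 1)) * ord l Q dvd s"
proof -
  define d where "d = ord l Q"
  define v where "v = multiplicity l (Q ^ d - 1)"
  have d0: "d > 0" using assms(3) by (simp add: d_def)
  have l_dvd: "int l dvd int Q ^ s - 1 \<longleftrightarrow> d dvd s" for s
    using ord_divides[of Q s l]
    by (simp add: d_def flip: cong_int_iff cong_iff_dvd_diff)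
  have v: "v = multiplicity (int l) (int Q ^ d - 1)"
    using assms(4) unfolding v_def by (simp add: of_nat_diff flip: multiplicity_of_nat_int)
  have "int l ^ k dvd int Q ^ s - 1 \<longleftrightarrow> l ^ (k - v) * d dvd s"
  proof (cases "d dvd s")
    case False
    hence "\<not> int l dvd int Q ^ s - 1" by (simp add: l_dvd)
    with False show ?thesis
      using assms(5) by (meson dvd_mult_right dvd_power dvd_trans)
  next
    case True
    then obtain j where j: "s = d * j" ..
    show ?thesis
    \<comment> \<open>For \<open>s = 0\<close> the difference is 0 and its multiplicity carries no
      information, but both sides hold trivially.\<close>
    proof (cases "j = 0")
      case False
      have g: "int Q ^ d > 1" using assms(4) d0 by (intro one_less_power) auto
      have m: "multiplicity (int l) (int Q ^ s - 1) = v + multiplicity l j"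
        unfolding j power_mult v
        by (rule multiplicity_power_diff_1) (use assms g False l_dvd in auto)
      have "int Q ^ s - 1 \<noteq> 0"
        using one_less_power[OF g, of j] False by (simp add: j power_mult)
      hence "int l ^ k dvd int Q ^ s - 1 \<longleftrightarrow> k \<le> v + multiplicity l j"
        using power_dvd_iff_le_multiplicity[of "int Q ^ s - 1" "int l" k] assms(1) m
        by (auto simp: prime_nat_iff)
      also have "\<dots> \<longleftrightarrow> l ^ (k - v) dvd j"
        using power_dvd_iff_le_multiplicity[of j l "k - v"] prime_gt_1_nat[OF assms(1)] False by auto
      also have "\<dots> \<longleftrightarrow> l ^ (k - v) * d dvd s"
        using d0 by (simp add: j mult.commute)
      finally show ?thesis .
    qed (simp add: j)
  qed
  thus ?thesis by (simp add: v_def d_def)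
qed

section \<open>Periods and sizes of cyclotomic cosets\<close>

lemma dvd_mult_iff_div_gcd:
  fixes a b M :: int
  assumes "M \<noteq> 0"
  shows "M dvd a * b \<longleftrightarrow> M div gcd a M dvd b"
proof -
  define g where "g = gcd a M"
  have g: "g \<noteq> 0" "a = g * (a div g)" "M = g * (M div g)" using assms by (auto simp: g_def)
  have c: "coprime (M div g) (a div g)"
    unfolding g_def using assms by (metis coprime_commute div_gcd_coprime)
  have "M dvd a * b \<longleftrightarrow> g * (M div g) dvd g * ((a div g) * b)"
    using g by (metis mult.assoc)
  also have "\<dots> \<longleftrightarrow> M div g dvd b"
    using g(1) c by (simp add: coprime_dvd_mult_right_iff)
  finally show ?thesis by (simp add: g_def)
qed

lemma coset_period_eqI:
  assumes "T > 0" and "\<And>t. [\<gamma> * int q ^ t = \<gamma>] (mod int M) \<longleftrightarrow> T dvd t"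
  shows "coset_period q M \<gamma> = T"
  unfolding coset_period_def
  by (rule Least_equality) (use assms in \<open>auto dest: dvd_imp_le\<close>)

text \<open>The congruence says that \<open>M\<close> divides \<open>\<gamma> * (q ^ t - 1)\<close>.
  Cancelling \<open>gcd \<gamma> M\<close> turns it into \<open>q ^ t = 1\<close> modulo
  \<open>N = M / gcd \<gamma> M\<close>, so the period is the order of \<open>q\<close> modulo
  \<open>N\<close>.\<close>

lemma coset_period:
  assumes "coprime q M" and "M > 0"
  shows coset_period_pos: "coset_period q M \<gamma> > 0"
    and cong_iff_coset_period_dvd: "[\<gamma> * int q ^ t = \<gamma>] (mod int M) \<longleftrightarrow> coset_period q M \<gamma> dvd t"
proof -
  define N where "N = nat (int M div gcd \<gamma> (int M))"
  have N: "int N = int M div gcd \<gamma> (int M)"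
    unfolding N_def by (simp add: pos_imp_zdiv_nonneg_iff assms)
  have "int N dvd int M" unfolding N by (metis dvd_div_mult_self dvd_triv_left gcd_dvd2)
  hence "coprime N q"
    using assms(1) by (metis coprime_commute coprime_divisors dvd_refl of_nat_dvd_iff)
  hence pos: "ord N q > 0" by simp
  have iff: "[\<gamma> * int q ^ t = \<gamma>] (mod int M) \<longleftrightarrow> ord N q dvd t" for t
  proof -
    have "[\<gamma> * int q ^ t = \<gamma>] (mod int M) \<longleftrightarrow> int M dvd \<gamma> * (int q ^ t - 1)"
      by (simp add: cong_iff_dvd_diff algebra_simps)
    also have "\<dots> \<longleftrightarrow> int N dvd int q ^ t - 1"
      using assms(2) by (simp add: N dvd_mult_iff_div_gcd)
    also have "\<dots> \<longleftrightarrow> ord N q dvd t"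
      using ord_divides[of q t N] by (simp flip: cong_int_iff cong_iff_dvd_diff)
    finally show ?thesis .
  qed
  have "coset_period q M \<gamma> = ord N q"
    using pos iff by (rule coset_period_eqI)
  thus "coset_period q M \<gamma> > 0"
    and "[\<gamma> * int q ^ t = \<gamma>] (mod int M) \<longleftrightarrow> coset_period q M \<gamma> dvd t"
    using pos iff by simp_all
qed

lemma card_cyclotomic_coset:
  assumes "coprime q M" and "M > 0"
  shows "card (cyclotomic_coset q M \<gamma>) = coset_period q M \<gamma>"
proof -
  define T where "T = coset_period q M \<gamma>"
  \<comment> \<open>If \<open>i < j\<close>, cancelling the unit \<open>q ^ i\<close> would make
    \<open>T\<close> divide \<open>j - i\<close>, which lies strictly between 0 and
    \<open>T\<close>. Exchanging \<open>i\<close> and \<open>j\<close> gives the other inequality,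
    hence injectivity.\<close>
  have *: "j \<le> i" if ij: "i < T" "j < T" and
    eq: "(\<gamma> * int q ^ i) mod int M = (\<gamma> * int q ^ j) mod int M" for i j
  proof (rule ccontr)
    assume "\<not> j \<le> i"
    hence "[\<gamma> * int q ^ (j - i) * int q ^ i = \<gamma> * int q ^ i] (mod int M)"
      using eq by (simp add: cong_def mult.assoc flip: power_add)
    hence "[\<gamma> * int q ^ (j - i) = \<gamma>] (mod int M)"
      using assms(1) by (subst (asm) cong_mult_rcancel) simp_all
    hence "T dvd j - i" using assms by (simp add: cong_iff_coset_period_dvd T_def)
    with \<open>\<not> j \<le> i\<close> ij show False by (auto dest: dvd_imp_le)
  qed
  have "inj_on (\<lambda>j. (\<gamma> * int q ^ j) mod int M) {..<T}"
    by (rule inj_onI) (use * in \<open>force intro: antisym\<close>)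
  thus ?thesis
    unfolding cyclotomic_coset_def by (simp add: card_image T_def)
qed

text \<open>The modulus splits into the coprime factors \<open>l ^ i\<close> and \<open>n\<close>.
  Modulo \<open>n\<close>, \<open>\<delta>\<close> may be replaced by \<open>\<gamma>\<close>, which
  forces \<open>t = \<tau> s\<close>; the condition modulo \<open>l ^ i\<close> then becomes
  \<open>D dvd s\<close>.\<close>

lemma card_cyclotomic_coset_lift:
  assumes "coprime q l" and "coprime q n" and "coprime l n" and "l > 0" and "n > 0"
    and "[\<delta> = \<gamma>] (mod int n)" and "\<tau> = card (cyclotomic_coset q n \<gamma>)"
    and "D > 0" and "\<And>s. int l ^ i dvd \<delta> * (int (q ^ \<tau>) ^ s - 1) \<longleftrightarrow> D dvd s"
  shows "card (cyclotomic_coset q (l ^ i * n) \<delta>) = D * \<tau>"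
proof -
  have \<tau>: "\<tau> = coset_period q n \<gamma>" "\<tau> > 0"
    using assms by (simp_all add: card_cyclotomic_coset coset_period_pos)
  have "coset_period q (l ^ i * n) \<delta> = D * \<tau>"
  proof (rule coset_period_eqI)
    fix t
    have "[\<delta> * int q ^ t = \<delta>] (mod int (l ^ i * n)) \<longleftrightarrow>
        int l ^ i * int n dvd \<delta> * (int q ^ t - 1)"
      by (simp add: cong_iff_dvd_diff algebra_simps)
    also have "\<dots> \<longleftrightarrow> int l ^ i dvd \<delta> * (int q ^ t - 1) \<and> int n dvd \<delta> * (int q ^ t - 1)"
      using assms(3) by (auto intro: divides_mult dest: dvd_mult_left dvd_mult_right)
    also have "int n dvd \<delta> * (int q ^ t - 1) \<longleftrightarrow> [\<gamma> * int q ^ t = \<gamma>] (mod int n)"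
    proof -
      have "[\<delta> * (int q ^ t - 1) = \<gamma> * (int q ^ t - 1)] (mod int n)"
        using assms(6) by (rule cong_scalar_right)
      from cong_dvd_iff[OF this] show ?thesis
        by (simp add: cong_iff_dvd_diff algebra_simps)
    qed
    also have "\<dots> \<longleftrightarrow> \<tau> dvd t"
      using assms(2,5) by (simp add: \<tau>(1) cong_iff_coset_period_dvd)
    also have "int l ^ i dvd \<delta> * (int q ^ t - 1) \<and> \<tau> dvd t \<longleftrightarrow> D * \<tau> dvd t"
    proof (cases "\<tau> dvd t")
      case True
      then obtain s where "t = \<tau> * s" ..
      thus ?thesis using assms(9)[of s] \<tau>(2) by (simp add: power_mult mult.commute[of D])
    qed (auto dest: dvd_mult_right)
    finally show "[\<delta> * int q ^ t = \<delta>] (mod int (l ^ i * n)) \<longleftrightarrow> D * \<tau> dvd t" .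
  qed (use assms \<tau> in auto)
  thus ?thesis using assms by (simp add: card_cyclotomic_coset)
qed


section \<open>The \<open>l\<close>-adic expansion of \<open>- \<gamma> / n\<close>\<close>

lemma ladic_abs_nonneg: "ladic_abs l x \<ge> 0"
  by (simp add: ladic_abs_def)

text \<open>The fraction need not be reduced: cross-multiplying with its reduced form
  \<open>c / d\<close> gives \<open>a d = c b\<close>, and since \<open>b\<close> is prime to
  \<open>l\<close>, the valuation of \<open>c / d\<close> is that of \<open>a\<close>.\<close>

lemma ladic_abs_le_iff:
  assumes "prime l" and "\<not> int l dvd b"
  shows "ladic_abs l (of_int a / of_int b) \<le> inverse (real l ^ N) \<longleftrightarrow> int l ^ N dvd a"
proof (cases "a = 0")
  case True
  thus ?thesis by (simp add: ladic_abs_def)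
next
  case False
  have l: "l > 1" using assms(1) by (rule prime_gt_1_nat)
  have b: "b \<noteq> 0" using assms(2) by auto
  define x where "x = (of_int a / of_int b :: rat)"
  obtain c d where cd: "quotient_of x = (c, d)" by (cases "quotient_of x")
  have d: "d > 0" using quotient_of_denom_pos[OF cd] .
  have "x \<noteq> 0" using False b by (simp add: x_def)
  have "of_int (a * d) = (of_int (c * b) :: rat)"
    using quotient_of_div[OF cd] d b by (simp add: x_def field_simps)
  hence eq: "a * d = c * b" by (simp only: of_int_eq_iff)
  have "c \<noteq> 0" using eq False d by auto
  have "multiplicity (int l) a + multiplicity (int l) d = multiplicity (int l) c + multiplicity (int l) b"
    using arg_cong[OF eq, of "multiplicity (int l)"] assms(1) False d \<open>c \<noteq> 0\<close> b
    by (simp add: prime_elem_multiplicity_mult_distrib)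
  hence "int (multiplicity (int l) d) - int (multiplicity (int l) c) = - int (multiplicity (int l) a)"
    using assms(2) by (simp add: not_dvd_imp_multiplicity_0)
  hence "ladic_abs l x = inverse (real l ^ multiplicity (int l) a)"
    using \<open>x \<noteq> 0\<close> by (simp add: ladic_abs_def cd power_int_minus)
  hence "ladic_abs l x \<le> inverse (real l ^ N) \<longleftrightarrow> N \<le> multiplicity (int l) a"
    using l by (simp add: inverse_le_iff_le)
  also have "\<dots> \<longleftrightarrow> int l ^ N dvd a"
    using power_dvd_iff_le_multiplicity[of a "int l" N] False l by auto
  finally show ?thesis by (simp add: x_def)
qed

lemma digit_sum_cong:
  fixes d :: "nat \<Rightarrow> int" and b :: int
  assumes "N \<le> M"
  shows "[(\<Sum>k<M. d k * b ^ k) = (\<Sum>k<N. d k * b ^ k)] (mod b ^ N)"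
  using assms
proof (induction M rule: dec_induct)
  case (step M)
  have "[d M * b ^ M = 0] (mod b ^ N)"
    using step by (simp add: cong_0_iff dvd_mult le_imp_power_dvd)
  from cong_add[OF step.IH this] show ?case by simp
qed simp

text \<open>Trades the limit for divisibility. The error of the partial sum \<open>S N\<close> is
  \<open>- (\<gamma> + n S N) / n\<close> with \<open>n\<close> prime to \<open>l\<close>, so a
  bound \<open>l^(-N)\<close> on its absolute value means that \<open>l ^ N\<close> divides the
  numerator.\<close>

lemma ladic_expansion_iff:
  fixes d :: "nat \<Rightarrow> int"
  assumes "prime l" and "\<not> l dvd n"
  shows "(\<lambda>N. ladic_abs l (- (of_int \<gamma> / of_nat n) - of_int (\<Sum>k<N. d k * int l ^ k))) \<longlonglongrightarrow> 0 \<longleftrightarrow>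
    (\<forall>N. int l ^ N dvd \<gamma> + int n * (\<Sum>k<N. d k * int l ^ k))"
    (is "?f \<longlonglongrightarrow> 0 \<longleftrightarrow> ?R")
proof -
  define S where "S N = (\<Sum>k<N. d k * int l ^ k)" for N
  have l: "l > 1" using assms(1) by (rule prime_gt_1_nat)
  have n: "n \<noteq> 0" using assms(2) by (metis dvd_0_right)
  have le: "?f M \<le> inverse (real l ^ N) \<longleftrightarrow> int l ^ N dvd \<gamma> + int n * S M" for M N
  proof -
    have "- (of_int \<gamma> / of_nat n) - of_int (S M) =
        (of_int (- (\<gamma> + int n * S M)) / of_int (int n) :: rat)"
      using n by (simp add: field_simps)
    moreover have "\<not> int l dvd int n" using assms(2) by simp
    ultimately show ?thesis
      using ladic_abs_le_iff[OF assms(1), of "int n" "- (\<gamma> + int n * S M)" N]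
      by (simp only: S_def dvd_minus_iff simp_thms)
  qed
  show ?thesis
  proof
    assume lim: "?f \<longlonglongrightarrow> 0"
    show ?R
    proof
      fix N
      have "eventually (\<lambda>M. ?f M < inverse (real l ^ N)) sequentially"
        using lim by (rule order_tendstoD) (use l in simp)
      then obtain M where M: "M \<ge> N" "?f M < inverse (real l ^ N)"
        by (metis (mono_tags, lifting) eventually_sequentially nle_le)
      hence "int l ^ N dvd \<gamma> + int n * S M" using le less_imp_le by blast
      \<comment> \<open>Convergence only controls some later partial sum \<open>S M\<close>; the
        digits from \<open>N\<close> on contribute multiples of \<open>l ^ N\<close>, so the
        divisibility passes back to \<open>S N\<close>.\<close>
      moreover have "[\<gamma> + int n * S M = \<gamma> + int n * S N] (mod int l ^ N)"
        unfolding S_def by (intro cong_add cong_mult cong_refl digit_sum_cong M)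
      ultimately show "int l ^ N dvd \<gamma> + int n * (\<Sum>k<N. d k * int l ^ k)"
        by (simp add: cong_dvd_iff S_def)
    qed
  next
    assume ?R
    show "?f \<longlonglongrightarrow> 0"
    proof (rule tendsto_sandwich)
      show "\<forall>\<^sub>F N in sequentially. 0 \<le> ?f N"
        by (intro always_eventually allI ladic_abs_nonneg)
      show "\<forall>\<^sub>F N in sequentially. ?f N \<le> inverse (real l ^ N)"
        using \<open>?R\<close> unfolding le S_def by (rule always_eventually)
      show "(\<lambda>N. inverse (real l ^ N)) \<longlonglongrightarrow> 0"
        using l by (intro LIMSEQ_inverse_realpow_zero) simp
    qed (rule tendsto_const)
  qed
qed

text \<open>Existence solves \<open>\<gamma> + n X = 0\<close> modulo every \<open>l ^ N\<close> and
  reads the digits off the solutions; uniqueness compares two expansions digit by digit.\<close>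

lemma ladic_expansion_ex1:
  assumes "prime l" and "\<not> l dvd n"
  shows "\<exists>!d. (\<forall>k. d k \<in> {0..int l - 1}) \<and>
    (\<forall>N. int l ^ N dvd \<gamma> + int n * (\<Sum>k<N. d k * int l ^ k))"
proof (rule ex_ex1I)
  have l: "l > 1" using assms(1) by (rule prime_gt_1_nat)
  have cop: "coprime (int n) (int l ^ N)" for N
    using assms by (simp add: prime_imp_coprime coprime_commute)
  have "\<exists>X. X \<in> {0..<int l ^ N} \<and> int l ^ N dvd \<gamma> + int n * X" for N
  proof -
    obtain y where y: "[int n * y = 1] (mod int l ^ N)"
      using cong_solve_coprime_int[OF cop] by blast
    have "[int n * ((- \<gamma> * y) mod int l ^ N) = int n * (- \<gamma> * y)] (mod int l ^ N)"
      by (intro cong_mult) auto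
    also have "int n * (- \<gamma> * y) = - \<gamma> * (int n * y)" by simp
    also have "[\<dots> = - \<gamma> * 1] (mod int l ^ N)"
      using y by (rule cong_scalar_left)
    finally have "int l ^ N dvd \<gamma> + int n * ((- \<gamma> * y) mod int l ^ N)"
      by (simp add: cong_iff_dvd_diff add.commute)
    thus ?thesis using l by (intro exI[of _ "(- \<gamma> * y) mod int l ^ N"]) simp
  qed
  then obtain X where X: "\<And>N. X N \<in> {0..<int l ^ N}" "\<And>N. int l ^ N dvd \<gamma> + int n * X N"
    by metis
  \<comment> \<open>Both numbers solve the same congruence modulo \<open>l ^ N\<close>, in which
    \<open>n\<close> is invertible. This compatibility makes the digits \<open>d\<close> sum to
    \<open>X N\<close>.\<close>
  have X_mod: "X (Suc N) mod int l ^ N = X N" for N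
  proof -
    have "int l ^ N dvd \<gamma> + int n * X (Suc N)"
      using X(2)[of "Suc N"] by (auto dest: dvd_mult_right)
    hence "int l ^ N dvd int n * (X (Suc N) - X N)"
      using dvd_diff[OF _ X(2)[of N]] by (fastforce simp: algebra_simps)
    hence "[X (Suc N) = X N] (mod int l ^ N)"
      using cop[of N] by (simp add: coprime_dvd_mult_right_iff coprime_commute cong_iff_dvd_diff)
    thus ?thesis using X(1)[of N] by (simp add: cong_def)
  qed
  define d where "d k = X (Suc k) div int l ^ k" for k
  have sum: "(\<Sum>k<N. d k * int l ^ k) = X N" for N
  proof (induction N)
    case 0
    show ?case using X(1)[of 0] by simp
  next
    case (Suc N)
    thus ?case using div_mult_mod_eq[of "X (Suc N)" "int l ^ N"] by (simp add: d_def X_mod)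
  qed
  have "d k \<in> {0..int l - 1}" for k
  proof -
    have "X (Suc k) div int l ^ k * int l ^ k \<le> X (Suc k)"
      using l by (simp flip: minus_mod_eq_div_mult)
    also have "\<dots> < int l * int l ^ k" using X(1)[of "Suc k"] by simp
    finally have "X (Suc k) div int l ^ k < int l"
      using l by simp
    thus ?thesis using X(1)[of "Suc k"] l by (simp add: d_def pos_imp_zdiv_nonneg_iff)
  qed
  thus "\<exists>d. (\<forall>k. d k \<in> {0..int l - 1}) \<and>
      (\<forall>N. int l ^ N dvd \<gamma> + int n * (\<Sum>k<N. d k * int l ^ k))"
    using X(2) sum by (intro exI[of _ d]) simp
next
  fix d d' :: "nat \<Rightarrow> int"
  have l: "l > 1" using assms(1) by (rule prime_gt_1_nat)
  have cop: "coprime (int l ^ N) (int n)" for N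
    using assms by (simp add: prime_imp_coprime)
  assume d: "(\<forall>k. d k \<in> {0..int l - 1}) \<and>
      (\<forall>N. int l ^ N dvd \<gamma> + int n * (\<Sum>k<N. d k * int l ^ k))"
    and d': "(\<forall>k. d' k \<in> {0..int l - 1}) \<and>
      (\<forall>N. int l ^ N dvd \<gamma> + int n * (\<Sum>k<N. d' k * int l ^ k))"
  have "d k = d' k" for k
  proof (induction k rule: less_induct)
    case (less k)
    have eq: "(\<Sum>i<k. d i * int l ^ i) = (\<Sum>i<k. d' i * int l ^ i)"
      using less by simp
    \<comment> \<open>The earlier digits agree and cancel, leaving
      \<open>n * l ^ k * (d k - d' k)\<close>. So \<open>l\<close> divides a difference of two
      digits, which is smaller than \<open>l\<close> in absolute value.\<close>
    have "int l ^ Suc k dvd (\<gamma> + int n * (\<Sum>i<Suc k. d i * int l ^ i))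
        - (\<gamma> + int n * (\<Sum>i<Suc k. d' i * int l ^ i))"
      using d d' by (intro dvd_diff) blast+
    also have "\<dots> = int n * (int l ^ k * (d k - d' k))"
      by (simp add: eq algebra_simps)
    finally have "int l ^ Suc k dvd int l ^ k * (d k - d' k)"
      using cop[of "Suc k"] by (simp only: coprime_dvd_mult_right_iff)
    hence "int l dvd d k - d' k" using l by (simp add: mult.commute)
    moreover have "\<bar>d k - d' k\<bar> < int l"
      using d d' by (smt (verit) atLeastAtMost_iff)
    ultimately show ?case using dvd_imp_le_int[of "d k - d' k" "int l"] by fastforce
  qed
  thus "d = d'" by auto
qed

text \<open>Once the limit inside the \<open>THE\<close> is rewritten as divisibilities, unique
  existence gives access to the digits.\<close>

lemma dvd_add_phi_digit_sum:
  assumes "prime l" and "\<not> l dvd n"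
  shows "int l ^ N dvd \<gamma> + int n * (\<Sum>k<N. phi_digit l n \<gamma> k * int l ^ k)"
proof -
  have "phi_digit l n \<gamma> = (THE d. (\<forall>k. d k \<in> {0..int l - 1}) \<and>
      (\<forall>N. int l ^ N dvd \<gamma> + int n * (\<Sum>k<N. d k * int l ^ k)))"
    unfolding phi_digit_def ladic_digits_def ladic_expansion_iff[OF assms] ..
  from theI'[OF ladic_expansion_ex1[OF assms, of \<gamma>], folded this]
  show ?thesis by simp
qed

text \<open>For \<open>i = 0\<close> the integer index is \<open>-1\<close> and both sums are
  empty.\<close>

lemma phi_trunc_eq: "phi_trunc l n \<gamma> (int i - 1) = (\<Sum>k<i. phi_digit l n \<gamma> k * int l ^ k)"
  unfolding phi_trunc_def by (rule sum.cong) auto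

text \<open>The true digits up to index \<open>m\<close> give a multiple of
  \<open>l ^ (m + 1)\<close>. Shifting digit \<open>m\<close> by \<open>\<sigma> a\<close> adds
  \<open>n * \<sigma> a * l ^ m\<close>, whose valuation is exactly \<open>m\<close>; everything
  else is a multiple of \<open>l ^ (m + 1)\<close>.\<close>

lemma U_int_valuation:
  assumes "prime l" and "\<not> l dvd n" and "\<sigma> a \<in> {1..int l - 1}"
  obtains w where "\<gamma> + int n * (U_int l n \<gamma> \<sigma> m a + int l ^ (m + 1) * t) = int l ^ m * w"
    and "\<not> int l dvd w"
proof -
  define f where "f = phi_digit l n \<gamma>"
  \<comment> \<open>The quotient lost when the shifted digit is reduced modulo \<open>l\<close>; it
    joins \<open>t\<close> in the multiple of \<open>l ^ (m + 1)\<close>.\<close>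
  define c where "c = (f m + \<sigma> a) div int l"
  obtain y where y: "\<gamma> + int n * (\<Sum>k<Suc m. f k * int l ^ k) = int l ^ Suc m * y"
    unfolding f_def by (rule dvdE[OF dvd_add_phi_digit_sum[OF assms(1,2)]])
  have u: "(f m + \<sigma> a) mod int l = f m + \<sigma> a - int l * c"
    unfolding c_def by (rule minus_mult_div_eq_mod [symmetric])
  have "\<gamma> + int n * (U_int l n \<gamma> \<sigma> m a + int l ^ (m + 1) * t)
      = (\<gamma> + int n * (\<Sum>k<Suc m. f k * int l ^ k)) + int l ^ m * (int n * \<sigma> a + int l * (int n * (t - c)))"
    unfolding U_int_def f_def[symmetric] u by (simp add: algebra_simps)
  also have "\<dots> = int l ^ m * (int n * \<sigma> a + int l * (y + int n * (t - c)))"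
    unfolding y by (simp add: algebra_simps)
  finally have eq: "\<gamma> + int n * (U_int l n \<gamma> \<sigma> m a + int l ^ (m + 1) * t)
      = int l ^ m * (int n * \<sigma> a + int l * (y + int n * (t - c)))" .
  have "\<not> int l dvd \<sigma> a" using assms(3) by (auto dest: zdvd_imp_le)
  hence "\<not> int l dvd int n * \<sigma> a"
    using assms(1,2) by (simp add: prime_dvd_mult_iff)
  hence "\<not> int l dvd int n * \<sigma> a + int l * (y + int n * (t - c))"
    by (simp add: dvd_add_left_iff)
  with eq show thesis by (rule that)
qed

section \<open>Coset sizes along the two kinds of sequence\<close>

theorem corollary5p2:
  fixes p e q l n \<tau> r v :: nat and \<gamma> :: int and \<sigma> :: "nat \<Rightarrow> int"
  assumes "prime p" and "e \<ge> 1" and "q = p ^ e"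
    and "prime l" and "odd l" and "l \<noteq> p"
    and "n \<ge> 1" and "\<not> p dvd n" and "\<not> l dvd n"
    and "\<tau> = card (cyclotomic_coset q n \<gamma>)"
    and "\<not> l dvd q ^ \<tau> - 1"
    and "r = (l - 1) div ord l (q ^ \<tau>)"
    and "v = multiplicity l (q ^ (\<tau> * ord l (q ^ \<tau>)) - 1)"
    and "strict_mono_on {1..r} \<sigma>"
    and "\<sigma> ` {1..r} \<subseteq> {1..int l - 1}"
    and "full_set_of_reps (unit_group_mod l)
           (generate (unit_group_mod l) {int (q ^ \<tau>) mod int l}) (\<sigma> ` {1..r})"
  shows "(\<forall>i. card (coset_seq_inf q l n \<gamma> i) = \<tau>) \<and>
    (\<forall>m. \<forall>a\<in>{1..r}. \<forall>t\<in>{0..l ^ (v - 1) - 1}. \<forall>i.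
       card (coset_seq q l n \<sigma> \<gamma> m a t i) =
         (if i \<le> m then \<tau>
          else if i \<le> m + v then ord l (q ^ \<tau>) * \<tau>
          else l ^ (i - m - v) * ord l (q ^ \<tau>) * \<tau>))"
proof -
  have coprime: "coprime q l" "coprime q n" "coprime l n"
    unfolding assms(3) using primes_coprime[OF assms(1,4)] assms(6)
      prime_imp_coprime[OF assms(1,8)] prime_imp_coprime[OF assms(4,9)] by simp_all
  have pos: "l > 0" "n > 0" using assms(4,7) by (simp_all add: prime_gt_0_nat)
  have "\<tau> > 0"
    unfolding assms(10) card_cyclotomic_coset[OF coprime(2) pos(2)]
    by (rule coset_period_pos[OF coprime(2) pos(2)])
  moreover have "q > 1"
    unfolding assms(3) using assms(2) prime_gt_1_nat[OF assms(1)] by (intro one_less_power) simp_all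
  ultimately have Q: "q ^ \<tau> > 1" by (intro one_less_power)
  have copQ: "coprime l (q ^ \<tau>)" using coprime(1) by (simp add: ac_simps)
  note lift = card_cyclotomic_coset_lift[OF coprime pos _ assms(10)]
  \<comment> \<open>Here \<open>l ^ i\<close> divides the representative itself, so the divisibility
    holds for every \<open>s\<close> and \<open>D = 1\<close>.\<close>
  have "card (coset_seq_inf q l n \<gamma> i) = \<tau>" for i
    unfolding coset_seq_inf_def phi_trunc_eq
    using lift[of _ 1 i] dvd_add_phi_digit_sum[OF assms(4,9), of i \<gamma>]
    by (simp add: cong_iff_dvd_diff)
  moreover have "card (coset_seq q l n \<sigma> \<gamma> m a t i) =
      (if i \<le> m then \<tau>
       else if i \<le> m + v then ord l (q ^ \<tau>) * \<tau>
       else l ^ (i - m - v) * ord l (q ^ \<tau>) * \<tau>)" if a: "a \<in> {1..r}" for m a t i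
  proof -
    define \<delta> where "\<delta> = \<gamma> + int n * (U_int l n \<gamma> \<sigma> m a + int l ^ (m + 1) * int t)"
    have "\<sigma> a \<in> {1..int l - 1}" using assms(15) a by blast
    then obtain w where w: "\<delta> = int l ^ m * w" "\<not> int l dvd w"
      unfolding \<delta>_def by (rule U_int_valuation[OF assms(4,9)])
    have \<delta>_cong: "[\<delta> = \<gamma>] (mod int n)" by (simp add: \<delta>_def cong_iff_dvd_diff)
    \<comment> \<open>Truncated subtraction gives \<open>i - m - v = 0\<close> for
      \<open>i \<le> m + v\<close>, so the second branch covers both the plateau and the growing
      range.\<close>
    define D where "D = (if i \<le> m then 1 else l ^ (i - m - v) * ord l (q ^ \<tau>))"
    have "int l ^ i dvd \<delta> * (int (q ^ \<tau>) ^ s - 1) \<longleftrightarrow> D dvd s" for s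
    proof (cases "i \<le> m")
      case True
      thus ?thesis by (simp add: D_def w(1) le_imp_power_dvd)
    next
      case False
      \<comment> \<open>Cancelling \<open>l ^ m\<close> and the factor \<open>w\<close> prime to
        \<open>l\<close> leaves a condition modulo \<open>l ^ (i - m)\<close> with positive
        exponent.\<close>
      have "coprime (int l ^ (i - m)) w"
        using assms(4) w(2) by (simp add: prime_imp_coprime)
      moreover have "int l ^ i = int l ^ m * int l ^ (i - m)"
        using False by (simp flip: power_add)
      ultimately have "int l ^ i dvd \<delta> * (int (q ^ \<tau>) ^ s - 1) \<longleftrightarrow>
          int l ^ (i - m) dvd int (q ^ \<tau>) ^ s - 1"
        using pos(1) by (simp add: w(1) mult.assoc coprime_dvd_mult_right_iff)
      thus ?thesis
        using prime_power_dvd_power_diff_1_iff[OF assms(4,5) copQ Q, of "i - m" s] False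
        by (simp add: D_def assms(13) power_mult)
    qed
    hence "card (coset_seq q l n \<sigma> \<gamma> m a t i) = D * \<tau>"
      unfolding coset_seq_def \<delta>_def[symmetric]
      using copQ pos by (intro lift[OF \<delta>_cong]) (simp_all add: D_def)
    thus ?thesis by (simp add: D_def)
  qed
  ultimately show ?thesis by blast
qed

end
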